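(* Let $\ell\ge 3$ be an integer and let $T=T(1,2,\ldots,\ell)$. Then $T$ is transmission irregular if and only if $\ell\notin\{r^2+1:\ r\ge 2\}$.
   Context: All graphs are finite, simple and connected; $d_G(u,v)$ is the shortest-path distance. The transmission of a vertex $v$ of $G$ is ${\rm Tr}_G(v)=\sum_{u\in V(G)} d_G(u,v)$. A graph is transmission irregular if all its vertices have pairwise different transmissions. For $t\ge 3$ and positive integers $k_1\le\cdots\le k_t$, the starlike tree $T(k_1,\ldots,k_t)$ is the tree obtained by attaching to a single vertex $t$ pendant paths of lengths $k_1,\ldots,k_t$. *)

theory Defs
  imports "Graph_Theory.Graph_Theory"
begin

text \<open>
  Finite simple graphs are the symmetric loop-free digraphs of \<^locale>\<open>pair_graph\<close>. The
  shortest-path distance is the library's weighted distance \<^const>\<open>wf_digraph.\<mu>\<close> with every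
  arc of weight 1. It is an extended real, which is finite on connected graphs.
\<close>

definition graph_dist :: "('a, 'b) pre_digraph \<Rightarrow> 'a \<Rightarrow> 'a \<Rightarrow> ereal" where
  "graph_dist G u v = wf_digraph.\<mu> G (\<lambda>_. 1) u v"

definition transmission :: "('a, 'b) pre_digraph \<Rightarrow> 'a \<Rightarrow> ereal" where
  "transmission G v = (\<Sum>u\<in>verts G. graph_dist G u v)"

definition transmission_irregular :: "('a, 'b) pre_digraph \<Rightarrow> bool" where
  "transmission_irregular G \<longleftrightarrow> inj_on (transmission G) (verts G)"

text \<open>
  \<open>Leg i j\<close> with \<open>j \<ge> 1\<close> is the \<open>j\<close>-th vertex, counted from the centre, of the pendant path
  with index \<open>i\<close>. Path indices start at 0, so that this path has length \<open>ks ! i\<close>.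
\<close>

datatype starlike_vertex = Center | Leg nat nat

definition starlike_edges :: "nat list \<Rightarrow> starlike_vertex rel" where
  "starlike_edges ks =
     {(Center, Leg i 1) |i. i < length ks \<and> 1 \<le> ks ! i} \<union>
     {(Leg i j, Leg i (j + 1)) |i j. i < length ks \<and> 1 \<le> j \<and> j + 1 \<le> ks ! i}"

definition starlike_tree :: "nat list \<Rightarrow> starlike_vertex pair_pre_digraph" where
  "starlike_tree ks =
     \<lparr> pverts = insert Center {Leg i j |i j. i < length ks \<and> 1 \<le> j \<and> j \<le> ks ! i},
       parcs = starlike_edges ks \<union> (starlike_edges ks)\<inverse> \<rparr>"

lemma pair_graph_starlike_tree: "pair_graph (starlike_tree ks)"
proof -
  let ?V = "insert Center {Leg i j |i j. i < length ks \<and> 1 \<le> j \<and> j \<le> ks ! i}"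
  have "?V \<subseteq> insert Center ((\<lambda>(i, j). Leg i j) ` (SIGMA i:{..<length ks}. {..ks ! i}))"
    by force
  then have V: "finite ?V"
    by (rule finite_subset) (intro finite.insertI finite_imageI finite_SigmaI; simp)
  have "parcs (starlike_tree ks) \<subseteq> ?V \<times> ?V"
    by (auto simp: starlike_tree_def starlike_edges_def)
  then have E: "finite (parcs (starlike_tree ks))"
    using finite_cartesian_product[OF V V] by (rule finite_subset)
  have S: "sym (parcs (starlike_tree ks))"
    by (auto simp: starlike_tree_def sym_def)
  show ?thesis
  proof
    show "\<And>e. e \<in> parcs (starlike_tree ks) \<Longrightarrow> fst e \<in> pverts (starlike_tree ks)"
      "\<And>e. e \<in> parcs (starlike_tree ks) \<Longrightarrow> snd e \<in> pverts (starlike_tree ks)"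
      "\<And>e. e \<in> parcs (starlike_tree ks) \<Longrightarrow> fst e \<noteq> snd e"
      by (auto simp: starlike_tree_def starlike_edges_def)
    show "finite (pverts (starlike_tree ks))"
      using V by (simp add: starlike_tree_def)
    show "finite (parcs (starlike_tree ks))" by (rule E)
    show "symmetric (starlike_tree ks)"
      using S by (simp add: symmetric_def)
  qed
qed

lemma connected_starlike_tree: "connected (starlike_tree ks)"
proof -
  let ?G = "with_proj (starlike_tree ks)"
  interpret graph ?G
    using pair_graph_starlike_tree by (rule pair_graph.pair_graphD_graph)
  have C: "Center \<in> verts ?G" by (simp add: starlike_tree_def)
  have leg: "Center \<rightarrow>\<^sup>*\<^bsub>?G\<^esub> Leg i (Suc j)" if "i < length ks" "Suc j \<le> ks ! i" for i j
    using that
  proof (induction j)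
    case 0
    then have "Center \<rightarrow>\<^bsub>?G\<^esub> Leg i (Suc 0)"
      by (auto simp: starlike_tree_def starlike_edges_def)
    then show ?case by (rule reachable_adjI)
  next
    case (Suc j)
    then have "Leg i (Suc j) \<rightarrow>\<^bsub>?G\<^esub> Leg i (Suc (Suc j))"
      by (auto simp: starlike_tree_def starlike_edges_def)
    moreover have "Center \<rightarrow>\<^sup>*\<^bsub>?G\<^esub> Leg i (Suc j)"
      using Suc by simp
    ultimately show ?case by (rule reachable_adj_trans[rotated])
  qed
  have from_C: "Center \<rightarrow>\<^sup>*\<^bsub>?G\<^esub> v" if "v \<in> verts ?G" for v
  proof (cases v)
    case Center
    then show ?thesis using reachable_refl[OF C] by simp
  next
    case (Leg i j)
    with that have "i < length ks" "1 \<le> j" "j \<le> ks ! i" by (auto simp: starlike_tree_def)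
    then show ?thesis using leg[of i "j - 1"] Leg by simp
  qed
  have "u \<rightarrow>\<^sup>*\<^bsub>?G\<^esub> v" if "u \<in> verts ?G" "v \<in> verts ?G" for u v
    using symmetric_reachable'[OF from_C[OF that(1)]] from_C[OF that(2)] by (rule reachable_trans)
  then have mk: "u \<rightarrow>\<^sup>*\<^bsub>mk_symmetric ?G\<^esub> v" if "u \<in> verts ?G" "v \<in> verts ?G" for u v
    using that by (intro reachable_mk_symmetricI)
  then show ?thesis
    unfolding connected_def strongly_connected_def with_proj_simps pverts_mk_symmetric
    using C[unfolded with_proj_simps] mk[unfolded with_proj_simps] by blast
qed

end

theory Submission
  imports Defs
begin

text \<open>
  Let \<open>N\<close> be the number of edges. The vertex at depth \<open>j\<close> of a leg of length \<open>k\<close> has transmission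
  \<open>j (N - 2 k + j)\<close> larger than the centre. For \<open>N = l (l + 1) / 2\<close> this excess is positive, and
  size estimates show that two vertices of equal transmission have consecutive depths \<open>j\<close> and
  \<open>j + 1\<close>. If their legs have lengths \<open>k = j + a\<close> and \<open>k' = l - b\<close>, equality reads
  \<open>(l - 2 j - 1)\<^sup>2 = l - 1 - 4 (b (j + 1) + a j)\<close>. With \<open>y = l - 2 j - 1\<close> the case
  \<open>a + b > 0\<close> would give \<open>y\<^sup>2 \<le> y - 2 j\<close>, which is impossible, so \<open>a = b = 0\<close> and \<open>l - 1\<close> is a
  square. Conversely, \<open>l = r\<^sup>2 + 1\<close> yields the collision with \<open>j = r (r - 1) / 2\<close>.
\<close>

section \<open>Distances\<close>

text \<open>Summing \<open>lipschitz\<close> along a walk bounds its length below by the potential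
  \<open>d\<close>; following \<open>descent\<close> until \<open>d\<close> reaches 0, which happens
  only at \<open>v\<close>, gives a walk of exactly that length.\<close>

lemma (in wf_digraph) graph_dist_eqI:
  fixes d :: "'a \<Rightarrow> nat"
  assumes u: "u \<in> verts G"
    and target: "d v = 0"
    and lipschitz: "\<And>e. e \<in> arcs G \<Longrightarrow> d (tail G e) \<le> Suc (d (head G e))"
    and descent: "\<And>w. w \<in> verts G \<Longrightarrow> w \<noteq> v \<Longrightarrow>
      \<exists>e\<in>arcs G. tail G e = w \<and> d w = Suc (d (head G e))"
  shows "graph_dist G u v = ereal (real (d u))"
proof -
  have cost: "awalk_cost (\<lambda>_. 1) p = real (length p)" for p
    by (simp add: awalk_cost_def sum_list_triv)
  have lower: "d w \<le> length p" if "awalk w p v" for w p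
    using that
  proof (induction p arbitrary: w)
    case Nil
    then show ?case using target by (simp add: awalk_Nil_iff)
  next
    case (Cons e p)
    then have "e \<in> arcs G" "tail G e = w" "awalk (head G e) p v"
      by (auto simp: awalk_Cons_iff)
    with Cons.IH[of "head G e"] lipschitz[of e] show ?case by simp
  qed
  have upper: "\<exists>p. awalk w p v \<and> length p = n" if "w \<in> verts G" "d w = n" for w n
    using that
  proof (induction n arbitrary: w)
    case 0
    with descent[of w] have "w = v" by force
    with 0 show ?case by (intro exI[of _ "[]"]) (simp add: awalk_Nil_iff)
  next
    case (Suc n)
    then have "w \<noteq> v" using target by auto
    with descent[of w] Suc.prems obtain e
      where e: "e \<in> arcs G" "tail G e = w" "d (head G e) = n" by auto
    with Suc.IH[of "head G e"] obtain p where "awalk (head G e) p v" "length p = n" by auto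
    with e show ?case by (intro exI[of _ "e # p"]) (simp add: awalk_Cons_iff)
  qed
  obtain p where p: "awalk u p v" "length p = d u" using upper[OF u refl] by blast
  have "\<mu> (\<lambda>_. 1) u v \<le> ereal (real (d u))"
    using min_cost_le_walk_cost[OF p(1), of "\<lambda>_. 1"] p(2) by (simp add: cost)
  moreover have "ereal (real (d u)) \<le> \<mu> (\<lambda>_. 1) u v"
    unfolding \<mu>_def by (rule INF_greatest) (auto simp: cost dest: lower)
  ultimately show ?thesis unfolding graph_dist_def by (rule antisym)
qed

text \<open>The truncated differences \<open>a - b\<close> and \<open>b - a\<close> add up to the absolute difference.\<close>

fun starlike_dist :: "starlike_vertex \<Rightarrow> starlike_vertex \<Rightarrow> nat" where
  "starlike_dist Center Center = 0"
| "starlike_dist Center (Leg i b) = b"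
| "starlike_dist (Leg i a) Center = a"
| "starlike_dist (Leg i a) (Leg i' b) = (if i = i' then (a - b) + (b - a) else a + b)"

lemma starlike_dist_self [simp]: "starlike_dist v v = 0"
  by (cases v) auto

lemma Leg_in_starlike_tree:
  "Leg i j \<in> pverts (starlike_tree ks) \<longleftrightarrow> i < length ks \<and> 1 \<le> j \<and> j \<le> ks ! i"
  by (simp add: starlike_tree_def)

text \<open>The neighbour \<open>w\<close> lies one step outward if \<open>v\<close> is deeper on
  the same leg, otherwise one step inward. Depth 1 is separate because the vertex before it is
  \<open>Center\<close>.\<close>

lemma starlike_descent:
  assumes "u \<in> pverts (starlike_tree ks)" "v \<in> pverts (starlike_tree ks)" "u \<noteq> v"
  shows "\<exists>w. (u, w) \<in> parcs (starlike_tree ks) \<and> starlike_dist u v = Suc (starlike_dist w v)"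
proof (cases u)
  case Center
  with assms obtain i b where v: "v = Leg i b" by (cases v) auto
  with assms have "i < length ks" "1 \<le> b" "b \<le> ks ! i" by (simp_all add: Leg_in_starlike_tree)
  with Center v show ?thesis
    by (intro exI[of _ "Leg i 1"]) (auto simp: starlike_tree_def starlike_edges_def)
next
  case (Leg i a)
  with assms have ia: "i < length ks" "1 \<le> a" "a \<le> ks ! i" by (simp_all add: Leg_in_starlike_tree)
  show ?thesis
  proof (cases "\<exists>b>a. v = Leg i b")
    case True
    then obtain b where b: "v = Leg i b" "b > a" by blast
    with assms have "b \<le> ks ! i" by (simp add: Leg_in_starlike_tree)
    with Leg b ia show ?thesis
      by (intro exI[of _ "Leg i (a + 1)"]) (auto simp: starlike_tree_def starlike_edges_def)
  next
    case inward: False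
    show ?thesis
    proof (cases "a = 1")
      case True
      with Leg ia have "(u, Center) \<in> parcs (starlike_tree ks)"
        by (auto simp: starlike_tree_def starlike_edges_def)
      moreover have "starlike_dist u v = Suc (starlike_dist Center v)"
        using Leg True inward assms(2,3) by (cases v) (auto simp: Leg_in_starlike_tree)
      ultimately show ?thesis by blast
    next
      case False
      with ia obtain c where c: "a = Suc c" "1 \<le> c" by (cases a) auto
      with Leg ia have "(u, Leg i c) \<in> parcs (starlike_tree ks)"
        by (auto simp: starlike_tree_def starlike_edges_def)
      moreover have "starlike_dist u v = Suc (starlike_dist (Leg i c) v)"
        using Leg c inward assms(3) by (cases v) auto
      ultimately show ?thesis by blast
    qed
  qed
qed

lemma graph_dist_starlike_tree:
  assumes "u \<in> pverts (starlike_tree ks)" "v \<in> pverts (starlike_tree ks)"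
  shows "graph_dist (starlike_tree ks) u v = ereal (real (starlike_dist u v))"
proof -
  interpret graph "with_proj (starlike_tree ks)"
    using pair_graph_starlike_tree by (rule pair_graph.pair_graphD_graph)
  show ?thesis
  proof (rule graph_dist_eqI)
    fix e assume "e \<in> arcs (with_proj (starlike_tree ks))"
    then show "starlike_dist (tail (with_proj (starlike_tree ks)) e) v
        \<le> Suc (starlike_dist (head (with_proj (starlike_tree ks)) e) v)"
      by (cases v) (auto simp: starlike_tree_def starlike_edges_def)
  next
    fix w assume "w \<in> verts (with_proj (starlike_tree ks))" "w \<noteq> v"
    then obtain x where "(w, x) \<in> parcs (starlike_tree ks)"
      "starlike_dist w v = Suc (starlike_dist x v)"
      using starlike_descent[OF _ assms(2), of w] by auto
    then show "\<exists>e\<in>arcs (with_proj (starlike_tree ks)). tail (with_proj (starlike_tree ks)) e = w \<and>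
        starlike_dist w v = Suc (starlike_dist (head (with_proj (starlike_tree ks)) e) v)"
      by (intro bexI[of _ "(w, x)"]) simp_all
  qed (use assms in simp_all)
qed

section \<open>Transmissions\<close>

definition starlike_transmission :: "nat list \<Rightarrow> starlike_vertex \<Rightarrow> nat" where
  "starlike_transmission ks v = (\<Sum>u\<in>pverts (starlike_tree ks). starlike_dist u v)"

lemma transmission_starlike_tree:
  assumes "v \<in> pverts (starlike_tree ks)"
  shows "transmission (starlike_tree ks) v = ereal (real (starlike_transmission ks v))"
proof -
  have "transmission (starlike_tree ks) v =
      (\<Sum>u\<in>pverts (starlike_tree ks). ereal (real (starlike_dist u v)))"
    unfolding transmission_def with_proj_simps
    by (rule sum.cong) (simp_all add: graph_dist_starlike_tree[OF _ assms])
  then show ?thesis by (simp add: starlike_transmission_def)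
qed

lemma sum_pverts_starlike_tree:
  "(\<Sum>u\<in>pverts (starlike_tree ks). f u) =
    f Center + (\<Sum>i<length ks. \<Sum>m=1..ks ! i. f (Leg i m))"
proof -
  let ?S = "SIGMA i:{..<length ks}. {1..ks ! i}"
  have V: "pverts (starlike_tree ks) = insert Center (case_prod Leg ` ?S)"
    by (force simp: starlike_tree_def)
  have "inj_on (case_prod Leg) ?S" by (auto simp: inj_on_def)
  then have "sum f (case_prod Leg ` ?S) = (\<Sum>(i, m)\<in>?S. f (Leg i m))"
    by (subst sum.reindex) (auto intro: sum.cong)
  also have "\<dots> = (\<Sum>i<length ks. \<Sum>m=1..ks ! i. f (Leg i m))"
    by (subst sum.Sigma) auto
  finally show ?thesis unfolding V by (subst sum.insert) auto
qed

text \<open>The summand is \<open>j - 2 * m\<close> for \<open>m \<le> j\<close> and constantly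
  \<open>- j\<close> beyond. Hence the induction starts at \<open>k = j\<close>, whose base case is
  itself an induction over the prefixes \<open>n \<le> j\<close>.\<close>

lemma sum_own_leg:
  fixes j k :: nat
  assumes "j \<le> k"
  shows "(\<Sum>m=1..k. int ((m - j) + (j - m)) - int m) = int j * (int j - int k - 1)"
  using assms
proof (induction k rule: dec_induct)
  case base
  have "(\<Sum>m=1..n. int ((m - j) + (j - m)) - int m) = int n * (int j - int n - 1)"
    if "n \<le> j" for n
    using that by (induction n) (auto simp: algebra_simps of_nat_diff)
  then show ?case by simp
next
  case (step k)
  then show ?case by (simp add: algebra_simps of_nat_diff)
qed

text \<open>Moving from the centre to depth \<open>j\<close> lengthens the distance to every vertex
  off leg \<open>i\<close> by \<open>j\<close>; only leg \<open>i\<close> needs a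
  correction.\<close>

lemma starlike_transmission_Leg:
  assumes "i < length ks" "j \<le> ks ! i"
  shows "int (starlike_transmission ks (Leg i j)) = int (starlike_transmission ks Center)
    + int j * (int (sum_list ks) - 2 * int (ks ! i) + int j)"
proof -
  let ?D = "\<lambda>u. int (starlike_dist u (Leg i j)) - int (starlike_dist u Center)"
  have leg: "(\<Sum>m=1..ks ! p. ?D (Leg p m)) =
      int j * int (ks ! p) + (if p = i then int j * (int j - 2 * int (ks ! i) - 1) else 0)" for p
    using sum_own_leg[OF assms(2)] by (auto simp: algebra_simps)
  have "int (starlike_transmission ks (Leg i j)) - int (starlike_transmission ks Center)
      = (\<Sum>u\<in>pverts (starlike_tree ks). ?D u)"
    by (simp add: starlike_transmission_def sum_subtractf)
  \<comment> \<open>The leading \<open>int j\<close> comes from \<open>u = Center\<close>; it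
    finally cancels the \<open>- 1\<close> in the correction for leg \<open>i\<close>.\<close>
  also have "\<dots> = int j + (\<Sum>p<length ks. \<Sum>m=1..ks ! p. ?D (Leg p m))"
    by (simp add: sum_pverts_starlike_tree)
  also have "\<dots> = int j + (\<Sum>p<length ks. int j * int (ks ! p))
      + int j * (int j - 2 * int (ks ! i) - 1)"
    unfolding leg using assms(1) by (simp add: sum.distrib)
  also have "(\<Sum>p<length ks. int j * int (ks ! p)) = int j * int (sum_list ks)"
    by (simp add: sum_list_sum_nth sum_distrib_left atLeast0LessThan)
  finally show ?thesis by (simp add: algebra_simps)
qed

section \<open>Collisions\<close>

text \<open>For a depth gap \<open>d \<ge> 2\<close>, the extreme values \<open>k = j\<close> and
  \<open>k' = l\<close> bound \<open>N * d\<close> from above, while \<open>N\<close> is about half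
  of \<open>l * l\<close>, which is too large.\<close>

lemma collision_consecutive:
  fixes l j k j' k' N :: int
  assumes N: "2 * N = l * (l + 1)"
    and bounds: "1 \<le> j" "j \<le> k" "j < j'" "k' \<le> l"
    and eq: "j * (N - 2 * k + j) = j' * (N - 2 * k' + j')"
  shows "j' = j + 1"
proof (rule ccontr)
  define d where "d = j' - j"
  have j': "j' = j + d" by (simp add: d_def)
  assume "j' \<noteq> j + 1"
  with bounds have d: "2 \<le> d" by (simp add: d_def)
  have "j * j \<le> j * k" "j' * k' \<le> j' * l"
    using bounds by (auto intro: mult_left_mono)
  moreover have "N * d = 2 * (j' * k') - j' * j' - 2 * (j * k) + j * j"
    using eq by (simp add: j' algebra_simps)
  ultimately have "N * d \<le> 2 * (j' * l) - j' * j' - j * j" by linarith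
  then have "2 * (N * d) \<le> 2 * (2 * (j' * l) - j' * j' - j * j)" by simp
  \<comment> \<open>Completing the square in \<open>j\<close> makes the bound independent of
    \<open>j\<close>.\<close>
  also have "\<dots> = l * l + 2 * l * d - d * d - (l - d - 2 * j) * (l - d - 2 * j)"
    by (simp add: j' algebra_simps)
  also have "\<dots> \<le> l * l + 2 * l * d - d * d" by simp
  finally have "2 * (N * d) \<le> l * l + 2 * l * d - d * d" .
  moreover define e where "e = l * l - l"
  moreover have "2 * (N * d) = d * e + 2 * l * d"
    using arg_cong[OF N, of "\<lambda>x. x * d"] by (simp add: e_def algebra_simps)
  ultimately have "d * e + d * d \<le> l * l" by linarith
  moreover have "0 \<le> e"
    using zero_le_mult_iff[of l "l - 1"] by (auto simp: e_def algebra_simps)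
  with d have "2 * e \<le> d * e" by (rule mult_right_mono)
  moreover have "2 * 2 \<le> d * d" using d by (intro mult_mono) auto
  moreover have "0 \<le> (l - 1) * (l - 1)" by simp
  then have "l * l \<le> 2 * e + 1" by (simp add: e_def algebra_simps)
  ultimately show False by linarith
qed

lemma collision_square:
  fixes l j k j' k' N :: int
  assumes N: "2 * N = l * (l + 1)"
    and bounds: "1 \<le> j" "j \<le> k" "j < j'" "k' \<le> l"
    and eq: "j * (N - 2 * k + j) = j' * (N - 2 * k' + j')"
  shows "(l - 2 * j - 1)\<^sup>2 = l - 1"
proof -
  have j': "j' = j + 1" using assms by (rule collision_consecutive)
  define a b y where "a = k - j" and "b = l - k'" and "y = l - 2 * j - 1"
  have ab: "0 \<le> a" "0 \<le> b" using bounds by (simp_all add: a_def b_def)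
  have k: "k = j + a" "k' = l - b" by (simp_all add: a_def b_def)
  \<comment> \<open>The coefficients \<open>j\<close> and \<open>j + 1\<close> of \<open>N\<close>
    in \<open>eq\<close> differ by one, so \<open>eq\<close> can be solved for
    \<open>N\<close>.\<close>
  have "N = 2 * (j + 1) * (l - b) - (j + 1) * (j + 1) - 2 * j * (j + a) + j * j"
    using eq by (simp add: j' k algebra_simps)
  with N have y: "y * y = l - 1 - 4 * (b * (j + 1) + a * j)"
    by (simp add: y_def algebra_simps)
  have "a = 0 \<and> b = 0"
  proof (rule ccontr)
    assume "\<not> (a = 0 \<and> b = 0)"
    with ab have "1 * j \<le> (a + b) * j" using bounds by (intro mult_right_mono) auto
    then have "j \<le> b * (j + 1) + a * j" using ab by (simp add: algebra_simps)
    \<comment> \<open>Subtracting at least \<open>4 * j\<close> from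
      \<open>l - 1 = y + 2 * j\<close> leaves at most \<open>y - 2 * j\<close>.\<close>
    with y bounds have "y * y < y" by (simp add: y_def)
    moreover have "y \<le> y * y"
      using zero_le_mult_iff[of y "y - 1"] by (auto simp: algebra_simps)
    ultimately show False by simp
  qed
  with y show ?thesis by (simp add: y_def power2_eq_square)
qed

theorem theorem2p5:
  fixes l :: nat
  assumes "l \<ge> 3"
  shows "transmission_irregular (starlike_tree [1..<l + 1]) \<longleftrightarrow> l \<notin> {r^2 + 1 |r. r \<ge> 2}"
proof -
  define ks where "ks = [1..<l + 1]"
  define N where "N = int (sum_list ks)"
  let ?V = "pverts (starlike_tree ks)"
  let ?T = "starlike_transmission ks"
  have N: "2 * N = int l * (int l + 1)"
    unfolding N_def ks_def by (induction l) (auto simp: algebra_simps)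
  have leg_iff: "Leg i j \<in> ?V \<longleftrightarrow> i < l \<and> 1 \<le> j \<and> j \<le> i + 1" for i j
    by (auto simp: Leg_in_starlike_tree ks_def simp del: upt_Suc)
  have T: "int (?T (Leg i j)) = int (?T Center) + int j * (N - 2 * int (i + 1) + int j)"
    if "Leg i j \<in> ?V" for i j
  proof -
    have "length ks = l" by (simp add: ks_def)
    moreover have "ks ! i = i + 1" using that unfolding leg_iff by (simp add: ks_def del: upt_Suc)
    ultimately show ?thesis
      using that starlike_transmission_Leg[of i ks j] by (simp add: leg_iff N_def)
  qed
  \<comment> \<open>The centre takes part in no collision: \<open>l \<ge> 3\<close> gives
    \<open>N \<ge> 2 * l\<close>, and no leg is longer than \<open>l\<close>.\<close>
  have center: "?T Center < ?T (Leg i j)" if "Leg i j \<in> ?V" for i j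
  proof -
    have "0 \<le> int l * (int l - 3)" using assms by simp
    then have "2 * (2 * int l) \<le> 2 * N" using N by (simp add: algebra_simps)
    then have "0 < N - 2 * int (i + 1) + int j" using that by (simp add: leg_iff)
    then have "0 < int j * (N - 2 * int (i + 1) + int j)"
      using that by (intro mult_pos_pos) (auto simp: leg_iff)
    with T[OF that] show ?thesis by linarith
  qed
  have irregular_iff: "transmission_irregular (starlike_tree ks) \<longleftrightarrow> inj_on ?T ?V"
    by (simp add: transmission_irregular_def inj_on_def transmission_starlike_tree)
  have square: "\<exists>r\<ge>2. l = r^2 + 1"
    if u: "Leg i j \<in> ?V" and v: "Leg i' j' \<in> ?V" and "j < j'"
      and eq: "?T (Leg i j) = ?T (Leg i' j')" for i j i' j'
  proof -
    have coll: "int j * (N - 2 * int (i + 1) + int j) = int j' * (N - 2 * int (i' + 1) + int j')"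
      using T[OF u] T[OF v] eq by simp
    have sq: "(int l - 2 * int j - 1)\<^sup>2 = int l - 1"
      by (rule collision_square[OF N _ _ _ _ coll]) (use u v \<open>j < j'\<close> in \<open>auto simp: leg_iff\<close>)
    \<comment> \<open>The root may be negative. Values of \<open>r\<close> below 2 would give
      \<open>l \<le> 2\<close>.\<close>
    define r where "r = nat \<bar>int l - 2 * int j - 1\<bar>"
    have "int (r\<^sup>2 + 1) = int l" using sq by (simp add: r_def)
    then have l: "l = r\<^sup>2 + 1" by linarith
    have "2 \<le> r"
    proof (rule ccontr)
      assume "\<not> 2 \<le> r"
      then have "r = 0 \<or> r = 1" by auto
      with l assms show False by auto
    qed
    with l show ?thesis by blast
  qed
  have "inj_on ?T ?V" if "\<not> (\<exists>r\<ge>2. l = r^2 + 1)"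
  proof (rule inj_onI)
    fix u v assume uv: "u \<in> ?V" "v \<in> ?V" "?T u = ?T v"
    show "u = v"
    proof (cases u)
      case Center
      with uv center show ?thesis by (cases v) force+
    next
      case u: (Leg i j)
      show ?thesis
      proof (cases v)
        case Center
        with u uv center show ?thesis by force
      next
        case v: (Leg i' j')
        \<comment> \<open>\<open>square\<close> excludes both orders of unequal depths; at equal
          positive depth the excess determines the leg.\<close>
        have "j = j'" using square uv that unfolding u v by (metis nat_neq_iff)
        moreover have "0 < int j" using uv u by (simp add: leg_iff)
        moreover have "int j * (N - 2 * int (i + 1) + int j)
            = int j' * (N - 2 * int (i' + 1) + int j')"
          using T[OF uv(1)[unfolded u]] T[OF uv(2)[unfolded v]] uv(3)[unfolded u v] by linarith
        ultimately have "N - 2 * int (i + 1) + int j = N - 2 * int (i' + 1) + int j'" by simp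
        with \<open>j = j'\<close> show ?thesis unfolding u v by simp
      qed
    qed
  qed
  moreover have "\<not> inj_on ?T ?V" if "2 \<le> r" and l: "l = r^2 + 1" for r
  proof
    assume inj: "inj_on ?T ?V"
    \<comment> \<open>Solves \<open>l - 2 * j - 1 = r\<close> for \<open>l = r^2 + 1\<close>; the
      division is exact.\<close>
    define j where "j = r * (r - 1) div 2"
    have "even (r * (r - 1))" by auto
    then have "2 * j = r * (r - 1)" unfolding j_def by simp
    moreover have "int (r * (r - 1)) = int r * (int r - 1)" using that by (simp add: of_nat_diff)
    ultimately have j: "2 * int j = int r * (int r - 1)"
      by (metis of_nat_mult of_nat_numeral)
    have "2 * 1 \<le> int r * (int r - 1)" using that by (intro mult_mono) auto
    with j have "1 \<le> j" by linarith
    have L: "int l = int r * int r + 1" by (simp add: l power2_eq_square)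
    then have "2 * int j + int r + 1 = int l" using j by (simp add: algebra_simps)
    then have "j + 1 \<le> l" by linarith
    \<comment> \<open>The case \<open>a = b = 0\<close> of \<open>collision_square\<close>: the end
      of the leg of length \<open>j\<close>, and depth \<open>j + 1\<close> on the longest
      leg.\<close>
    have V: "Leg (j - 1) j \<in> ?V" "Leg (l - 1) (j + 1) \<in> ?V"
      using \<open>1 \<le> j\<close> \<open>j + 1 \<le> l\<close> by (simp_all add: leg_iff)
    have "int r = int l - 2 * int j - 1" using \<open>2 * int j + int r + 1 = int l\<close> by simp
    then have "(int l - 2 * int j - 1) * (int l - 2 * int j - 1) = int l - 1" using L by simp
    with N have coll: "int j * (N - 2 * int j + int j) = (int j + 1) * (N - 2 * int l + (int j + 1))"
      by (simp add: algebra_simps)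
    have idx: "j - 1 + 1 = j" "l - 1 + 1 = l" "int (j + 1) = int j + 1"
      using \<open>1 \<le> j\<close> assms by simp_all
    have eq: "?T (Leg (j - 1) j) = ?T (Leg (l - 1) (j + 1))"
      using T[OF V(1)] T[OF V(2)] coll unfolding idx by linarith
    have "Leg (j - 1) j = Leg (l - 1) (j + 1)" by (rule inj_onD[OF inj eq V])
    then show False by simp
  qed
  ultimately show ?thesis unfolding ks_def[symmetric] irregular_iff by blast
qed

end
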